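(* Let $r\ge 2$ and $n\ge 1$ be integers. Then $$\mathrm{LAS}^{(r)}_{\Delta_n}\subseteq\mathcal K^{(r-2)}_n=\mathrm{LAS}^{(r)}_{\Delta_n,P}=\mathrm{LAS}^{(2r)}_{\mathbb S^{n-1}}.$$
   Context: $\mathcal S^n$ is the set of real symmetric $n\times n$ matrices, $[n]=\{1,\dots,n\}$. $\Sigma$ denotes the cone of sums of squares of polynomials in $\mathbb R[x]=\mathbb R[x_1,\dots,x_n]$; $\Sigma_k$ is the set of elements of $\Sigma$ of degree at most $k$ (with $\Sigma_k=\{0\}$ if $k<0$). $I_\Delta$ is the ideal of $\mathbb R[x]$ generated by $\sum_{i=1}^n x_i-1$; $x^{\circ 2}=(x_1^2,\dots,x_n^2)$; $x^S=\prod_{i\in S}x_i$ for $S\subseteq[n]$. For integers $r\ge 0$, $$\mathcal K^{(r)}_n=\Big\{M\in\mathcal S^n:\Big(\sum_{i=1}^n x_i^2\Big)^r (x^{\circ 2})^TMx^{\circ 2}\in\Sigma\Big\},$$ $$\mathrm{LAS}^{(r)}_{\Delta_n}=\Big\{M\in\mathcal S^n: x^TMx=\sigma_0+\sum_{i=1}^n\sigma_ix_i+q\ \text{ for some }\sigma_0\in\Sigma_r,\ \sigma_i\in\Sigma_{r-1},\ q\in I_\Delta\Big\},$$ $$\mathrm{LAS}^{(r)}_{\Delta_n,P}=\Big\{M\in\mathcal S^n: x^TMx=\sum_{S\subseteq[n],\,|S|\le r}\sigma_Sx^S+q\ \text{ for some }\sigma_S\in\Sigma_{r-|S|},\ q\in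 I_\Delta\Big\},$$ $$\mathrm{LAS}^{(r)}_{\mathbb S^{n-1}}=\Big\{M\in\mathcal S^n:(x^{\circ 2})^TMx^{\circ 2}=\sigma_0+u\Big(\sum_{i=1}^n x_i^2-1\Big)\ \text{ for some }\sigma_0\in\Sigma_r,\ u\in\mathbb R[x]\Big\}.$$ *)

theory Defs
  imports "HOL-Analysis.Analysis" "HOL-Library.Poly_Mapping"
begin

text \<open>
  \<open>'n rpoly\<close> is the polynomial ring over the reals with variables indexed by a finite type
  \<open>'n\<close>, i.e. finitely supported coefficient functions on exponent vectors, with convolution
  as multiplication. The type \<open>'n\<close> plays the role of \<open>[n]\<close>, and \<open>n = CARD('n)\<close>.
\<close>

type_synonym 'n rpoly = "('n \<Rightarrow>\<^sub>0 nat) \<Rightarrow>\<^sub>0 real"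

definition Var :: "'n \<Rightarrow> 'n rpoly" where
  "Var i = Poly_Mapping.single (Poly_Mapping.single i 1) 1"

definition Const :: "real \<Rightarrow> 'n rpoly" where
  "Const c = Poly_Mapping.single 0 c"

definition mon_degree :: "('n::finite \<Rightarrow>\<^sub>0 nat) \<Rightarrow> nat" where
  "mon_degree m = (\<Sum>i\<in>UNIV. Poly_Mapping.lookup m i)"

text \<open>The zero polynomial gets degree 0 here; \<open>SOS_deg\<close> below treats it separately.\<close>

definition total_degree :: "'n::finite rpoly \<Rightarrow> nat" where
  "total_degree p = Max (insert 0 (mon_degree ` Poly_Mapping.keys p))"

definition SOS :: "'n rpoly set" where
  "SOS = {p. \<exists>(m::nat) g. p = (\<Sum>i<m. (g i)\<^sup>2)}"

text \<open>The degree bound is an integer, so that \<open>SOS_deg k = {0}\<close> for \<open>k < 0\<close>.\<close>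

definition SOS_deg :: "int \<Rightarrow> 'n::finite rpoly set" where
  "SOS_deg k = {p \<in> SOS. p = 0 \<or> int (total_degree p) \<le> k}"

text \<open>A submodule of a commutative ring over itself is an ideal, so \<open>module.span (*) A\<close> is
  the ideal generated by \<open>A\<close>.\<close>

definition simplex_ideal :: "'n::finite rpoly set" where
  "simplex_ideal = module.span (*) {(\<Sum>i\<in>UNIV. Var i) - 1}"

lemma simplex_ideal_eq_range:
  "simplex_ideal = range (\<lambda>u::'n::finite rpoly. u * ((\<Sum>i\<in>UNIV. Var i) - 1))"
proof -
  interpret module "(*) :: 'n rpoly \<Rightarrow> 'n rpoly \<Rightarrow> 'n rpoly"
    by standard (simp_all add: algebra_simps)
  show ?thesis
    unfolding simplex_ideal_def by (rule span_singleton)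
qed

text \<open>\<open>quad_form M y\<close> is \<open>y\<^sup>T M y\<close> for a vector \<open>y\<close> of polynomials.\<close>

definition quad_form :: "real^'n^'n \<Rightarrow> ('n \<Rightarrow> 'n rpoly) \<Rightarrow> 'n::finite rpoly" where
  "quad_form M y = (\<Sum>i\<in>UNIV. \<Sum>j\<in>UNIV. y i * Const (M $ i $ j) * y j)"

definition sym_matrices :: "(real^'n^'n) set" where
  "sym_matrices = {M. transpose M = M}"

definition cone_K :: "nat \<Rightarrow> (real^'n^'n) set" where
  "cone_K r = {M \<in> sym_matrices.
     (\<Sum>i\<in>UNIV. (Var i)\<^sup>2) ^ r * quad_form M (\<lambda>i. (Var i)\<^sup>2) \<in> SOS}"

definition LAS_simplex :: "nat \<Rightarrow> (real^'n^'n) set" where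
  "LAS_simplex r = {M \<in> sym_matrices. \<exists>\<sigma>\<^sub>0 \<sigma> q.
     \<sigma>\<^sub>0 \<in> SOS_deg (int r) \<and> (\<forall>i. \<sigma> i \<in> SOS_deg (int r - 1)) \<and> q \<in> simplex_ideal \<and>
     quad_form M Var = \<sigma>\<^sub>0 + (\<Sum>i\<in>UNIV. \<sigma> i * Var i) + q}"

definition LAS_simplex_P :: "nat \<Rightarrow> (real^'n^'n) set" where
  "LAS_simplex_P r = {M \<in> sym_matrices. \<exists>\<sigma> q.
     (\<forall>S. card S \<le> r \<longrightarrow> \<sigma> S \<in> SOS_deg (int r - int (card S))) \<and> q \<in> simplex_ideal \<and>
     quad_form M Var = (\<Sum>S | card S \<le> r. \<sigma> S * (\<Prod>i\<in>S. Var i)) + q}"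

definition LAS_sphere :: "nat \<Rightarrow> (real^'n^'n) set" where
  "LAS_sphere r = {M \<in> sym_matrices. \<exists>\<sigma>\<^sub>0 u.
     \<sigma>\<^sub>0 \<in> SOS_deg (int r) \<and>
     quad_form M (\<lambda>i. (Var i)\<^sup>2) = \<sigma>\<^sub>0 + u * ((\<Sum>i\<in>UNIV. (Var i)\<^sup>2) - 1)}"

end

theory Submission
  imports Defs
begin

text \<open>
  The certificates are converted into one another in a cycle. Substituting \<open>x\<^sub>i\<^sup>2\<close> for \<open>x\<^sub>i\<close> turns a simplex certificate
  into a sphere certificate. A sphere certificate is first replaced by its part of even degree
  (which discards the products of even and odd terms and keeps a sum of squares) and then
  homogenized with powers of \<open>\<Sum>x\<^sub>i\<^sup>2\<close>; the result is exact, because a homogeneous multiple of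
  \<open>\<Sum>x\<^sub>i\<^sup>2 - 1\<close> vanishes. Finally, splitting the squares in a certificate for
  \<open>(\<Sum>x\<^sub>i\<^sup>2)\<^sup>r\<^sup>-\<^sup>2 (x\<^sup>2)\<^sup>T M x\<^sup>2\<close> by the parities of all exponents allows the substitution to be undone, and
  \<open>(\<Sum>x\<^sub>i)\<^sup>r\<^sup>-\<^sup>2\<close> is congruent to 1 modulo the ideal of the simplex.
\<close>

section \<open>Polynomials as finitely supported functions\<close>

lemma poly_mapping_sum_single:
  "(\<Sum>m\<in>Poly_Mapping.keys p. Poly_Mapping.single m (Poly_Mapping.lookup p m)) = p"
  by (rule poly_mapping_eqI) (auto simp: lookup_sum lookup_single when_def in_keys_iff)

lemma mult_eq_sum_single:
  fixes p q :: "'a::comm_monoid_add \<Rightarrow>\<^sub>0 'b::comm_semiring_0"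
  shows "p * q = (\<Sum>a\<in>Poly_Mapping.keys p. \<Sum>b\<in>Poly_Mapping.keys q.
    Poly_Mapping.single (a + b) (Poly_Mapping.lookup p a * Poly_Mapping.lookup q b))"
proof -
  have "p * q =
      (\<Sum>a\<in>Poly_Mapping.keys p. Poly_Mapping.single a (Poly_Mapping.lookup p a)) *
      (\<Sum>b\<in>Poly_Mapping.keys q. Poly_Mapping.single b (Poly_Mapping.lookup q b))"
    by (simp only: poly_mapping_sum_single)
  then show ?thesis
    by (simp only: sum_product mult_single)
qed

lemma lookup_mult_finite:
  fixes p q :: "'a::comm_monoid_add \<Rightarrow>\<^sub>0 'b::comm_semiring_0"
  shows "Poly_Mapping.lookup (p * q) k =
    (\<Sum>a\<in>Poly_Mapping.keys p. \<Sum>b\<in>Poly_Mapping.keys q.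
      Poly_Mapping.lookup p a * Poly_Mapping.lookup q b when a + b = k)"
  by (subst mult_eq_sum_single) (simp add: lookup_sum lookup_single)

text \<open>If \<open>a + b\<close> arises from the two supports in at most one way, no other term
  of the convolution reaches it. Neither \<open>a\<close> nor \<open>b\<close> has to lie in a
  support: if one does not, both sides are 0. Applied to extreme exponents, this rules out
  cancellation.\<close>

lemma lookup_mult_unique_sum:
  fixes p q :: "'a::comm_monoid_add \<Rightarrow>\<^sub>0 'b::comm_semiring_0"
  assumes "\<And>a' b'. a' \<in> Poly_Mapping.keys p \<Longrightarrow> b' \<in> Poly_Mapping.keys q \<Longrightarrow>
    a' + b' = a + b \<Longrightarrow> a' = a \<and> b' = b"
  shows "Poly_Mapping.lookup (p * q) (a + b) = Poly_Mapping.lookup p a * Poly_Mapping.lookup q b"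
proof -
  have "(Poly_Mapping.lookup p a' * Poly_Mapping.lookup q b' when a' + b' = a + b) =
      (if a' = a then if b' = b then Poly_Mapping.lookup p a * Poly_Mapping.lookup q b else 0 else 0)"
    if "a' \<in> Poly_Mapping.keys p" "b' \<in> Poly_Mapping.keys q" for a' b'
    using assms [OF that] by (auto simp: when_def)
  then have "Poly_Mapping.lookup (p * q) (a + b) =
      (\<Sum>a'\<in>Poly_Mapping.keys p. \<Sum>b'\<in>Poly_Mapping.keys q.
      if a' = a then if b' = b then Poly_Mapping.lookup p a * Poly_Mapping.lookup q b else 0 else 0)"
    unfolding lookup_mult_finite by (intro sum.cong refl) auto
  also have "\<dots> = (\<Sum>a'\<in>Poly_Mapping.keys p. if a' = a then
      (\<Sum>b'\<in>Poly_Mapping.keys q.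
        if b' = b then Poly_Mapping.lookup p a * Poly_Mapping.lookup q b else 0) else 0)"
    by (intro sum.cong refl) auto
  also have "\<dots> = Poly_Mapping.lookup p a * Poly_Mapping.lookup q b"
    by (auto simp: in_keys_iff)
  finally show ?thesis .
qed

lemma keys_multE:
  assumes "k \<in> Poly_Mapping.keys (p * q)"
  obtains a b where "a \<in> Poly_Mapping.keys p" "b \<in> Poly_Mapping.keys q" "k = a + b"
  using assms keys_mult [of p q] by blast

lemma keys_sumE:
  assumes "k \<in> Poly_Mapping.keys (\<Sum>i\<in>I. f i)"
  obtains i where "i \<in> I" "k \<in> Poly_Mapping.keys (f i)"
  using assms unfolding in_keys_iff lookup_sum by (meson sum.not_neutral_contains_not_neutral)

section \<open>Parts of a polynomial with prescribed exponents\<close>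

definition restr :: "('a \<Rightarrow> bool) \<Rightarrow> ('a \<Rightarrow>\<^sub>0 'b::comm_monoid_add) \<Rightarrow> 'a \<Rightarrow>\<^sub>0 'b" where
  "restr P p = Poly_Mapping.mapp (\<lambda>m c. c when P m) p"

lemma lookup_restr: "Poly_Mapping.lookup (restr P p) m = (Poly_Mapping.lookup p m when P m)"
  by (auto simp: restr_def lookup_mapp when_def in_keys_iff)

lemma keys_restr: "Poly_Mapping.keys (restr P p) = {m \<in> Poly_Mapping.keys p. P m}"
  by (auto simp: in_keys_iff lookup_restr when_def split: if_splits)

lemma restr_sum: "restr P (\<Sum>i\<in>I. f i) = (\<Sum>i\<in>I. restr P (f i))"
  by (rule poly_mapping_eqI) (auto simp: lookup_sum lookup_restr when_def)

lemma restr_add: "restr P (p + q) = restr P p + restr P q"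
  by (rule poly_mapping_eqI) (auto simp: lookup_add lookup_restr when_def)

lemma restr_id: "(\<And>m. m \<in> Poly_Mapping.keys p \<Longrightarrow> P m) \<Longrightarrow> restr P p = p"
  by (rule poly_mapping_eqI) (auto simp: lookup_restr when_def in_keys_iff)

lemma restr_eq_0: "(\<And>m. m \<in> Poly_Mapping.keys p \<Longrightarrow> \<not> P m) \<Longrightarrow> restr P p = 0"
  by (rule poly_mapping_eqI) (auto simp: lookup_restr when_def in_keys_iff)

lemma sum_restr_fibres:
  fixes \<phi> :: "'a \<Rightarrow> 'c::finite"
  shows "(\<Sum>c\<in>UNIV. restr (\<lambda>m. \<phi> m = c) p) = p"
  by (rule poly_mapping_eqI) (simp add: lookup_sum lookup_restr when_def)

text \<open>The assumption says that a product of two monomials satisfies \<open>P\<close> exactly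
  if both lie in the same class of \<open>\<phi>\<close>. Products across classes therefore vanish
  and products within a class survive whole. The classes used below are the parity of the degree and
  the set of variables with odd exponent.\<close>

lemma restr_mult:
  fixes \<phi> :: "'a::comm_monoid_add \<Rightarrow> 'c::finite"
    and p q :: "'a \<Rightarrow>\<^sub>0 'b::comm_semiring_0"
  assumes "\<And>a b. P (a + b) \<longleftrightarrow> \<phi> a = \<phi> b"
  shows "restr P (p * q) = (\<Sum>c\<in>UNIV. restr (\<lambda>m. \<phi> m = c) p * restr (\<lambda>m. \<phi> m = c) q)"
proof -
  have "restr P (restr (\<lambda>m. \<phi> m = c) p * restr (\<lambda>m. \<phi> m = d) q) =
      (if d = c then restr (\<lambda>m. \<phi> m = c) p * restr (\<lambda>m. \<phi> m = c) q else 0)" for c d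
    by (auto intro!: restr_id restr_eq_0 elim!: keys_multE simp: keys_restr assms)
  then show ?thesis
    by (subst sum_restr_fibres [of \<phi> p, symmetric], subst sum_restr_fibres [of \<phi> q, symmetric])
       (simp add: sum_product restr_sum)
qed

section \<open>Degrees\<close>

lemma mon_degree_zero [simp]: "mon_degree 0 = 0"
  by (simp add: mon_degree_def)

lemma mon_degree_add [simp]: "mon_degree (a + b) = mon_degree a + mon_degree b"
  by (simp add: mon_degree_def lookup_add sum.distrib)

lemma mon_degree_single [simp]: "mon_degree (Poly_Mapping.single i k) = k"
  by (simp add: mon_degree_def lookup_single when_def)

lemma mon_degree_sum: "mon_degree (\<Sum>i\<in>I. f i) = (\<Sum>i\<in>I. mon_degree (f i))"
  by (induction I rule: infinite_finite_induct) auto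

text \<open>Like \<open>homog\<close> below, this is a condition on the support only, so the zero
  polynomial satisfies it for every \<open>d\<close> and cancellation in sums does no harm.\<close>

definition deg_le :: "nat \<Rightarrow> 'n::finite rpoly \<Rightarrow> bool" where
  "deg_le d p \<longleftrightarrow> (\<forall>m\<in>Poly_Mapping.keys p. mon_degree m \<le> d)"

definition homog :: "nat \<Rightarrow> 'n::finite rpoly \<Rightarrow> bool" where
  "homog d p \<longleftrightarrow> (\<forall>m\<in>Poly_Mapping.keys p. mon_degree m = d)"

lemma total_degree_le_iff: "total_degree p \<le> d \<longleftrightarrow> deg_le d p"
  by (simp add: total_degree_def deg_le_def)

lemma deg_le_zero [simp]: "deg_le d 0"
  by (simp add: deg_le_def)

lemma deg_le_sum: "(\<And>i. i \<in> I \<Longrightarrow> deg_le d (f i)) \<Longrightarrow> deg_le d (\<Sum>i\<in>I. f i)"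
  by (auto simp: deg_le_def elim!: keys_sumE)

lemma deg_le_mult: "deg_le d p \<Longrightarrow> deg_le e q \<Longrightarrow> deg_le (d + e) (p * q)"
  by (fastforce simp: deg_le_def elim!: keys_multE intro: add_mono)

lemma homog_imp_deg_le: "homog d p \<Longrightarrow> deg_le d p"
  by (simp add: deg_le_def homog_def)

lemma homog_sum: "(\<And>i. i \<in> I \<Longrightarrow> homog d (f i)) \<Longrightarrow> homog d (\<Sum>i\<in>I. f i)"
  by (auto simp: homog_def elim!: keys_sumE)

lemma homog_diff: "homog d p \<Longrightarrow> homog d q \<Longrightarrow> homog d (p - q)"
  using keys_diff by (fastforce simp: homog_def in_keys_iff lookup_minus)

lemma homog_mult: "homog d p \<Longrightarrow> homog e q \<Longrightarrow> homog (d + e) (p * q)"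
  by (fastforce simp: homog_def elim!: keys_multE)

lemma homog_one [simp]: "homog 0 1"
  by (simp add: homog_def)

lemma homog_power: "homog d p \<Longrightarrow> homog (k * d) (p ^ k)"
  by (induction k) (auto simp: homog_mult)

lemma homog_single: "homog (mon_degree m) (Poly_Mapping.single m c)"
  by (simp add: homog_def)

lemma homog_Var: "homog 1 (Var i)"
  unfolding Var_def using homog_single [of "Poly_Mapping.single i 1" 1] by simp

lemma homog_Const: "homog 0 (Const c)"
  by (simp add: homog_def Const_def)

lemma homog_quad_form:
  assumes "\<And>i. homog d (y i)"
  shows "homog (2 * d) (quad_form M y)"
proof -
  have "homog (d + 0 + d) (y i * Const (M $ i $ j) * y j)" for i j
    by (intro homog_mult assms homog_Const)
  then show ?thesis
    unfolding quad_form_def by (intro homog_sum) (simp add: mult_2)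
qed

section \<open>Sums of squares\<close>

lemma SOS_zero [simp]: "0 \<in> SOS"
  by (auto simp: SOS_def intro: exI [of _ "0::nat"])

lemma SOS_square: "g\<^sup>2 \<in> SOS"
  by (auto simp: SOS_def intro!: exI [of _ "1::nat"] exI [of _ "\<lambda>_. g"])

lemma SOS_add:
  assumes "p \<in> SOS" "q \<in> SOS"
  shows "p + q \<in> SOS"
proof -
  obtain m g k h where p: "p = (\<Sum>i<m::nat. (g i)\<^sup>2)" and q: "q = (\<Sum>i<k::nat. (h i)\<^sup>2)"
    using assms unfolding SOS_def by blast
  \<comment> \<open>The two lists of squares are concatenated; the length \<open>l\<close> of the
    second one is left free for the induction.\<close>
  have "(\<Sum>i<m + l. (if i < m then g i else h (i - m))\<^sup>2) = p + (\<Sum>i<l. (h i)\<^sup>2)" for l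
    by (induction l) (auto simp: p algebra_simps)
  then show ?thesis
    unfolding SOS_def q by (force intro: sym)
qed

lemma SOS_sum: "(\<And>i. i \<in> I \<Longrightarrow> f i \<in> SOS) \<Longrightarrow> (\<Sum>i\<in>I. f i) \<in> SOS"
  by (induction I rule: infinite_finite_induct) (auto intro: SOS_add)

lemma SOS_mult_square:
  assumes "p \<in> SOS"
  shows "c\<^sup>2 * p \<in> SOS"
proof -
  obtain m g where "p = (\<Sum>i<m::nat. (g i)\<^sup>2)"
    using assms unfolding SOS_def by blast
  then have "c\<^sup>2 * p = (\<Sum>i<m. (c * g i)\<^sup>2)"
    by (simp add: sum_distrib_left power_mult_distrib)
  then show ?thesis
    by (simp add: SOS_sum SOS_square)
qed

lemma SOS_deg_nat_iff: "p \<in> SOS_deg (int d) \<longleftrightarrow> p \<in> SOS \<and> deg_le d p"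
  by (auto simp: SOS_deg_def total_degree_le_iff)

text \<open>The Euclidean norm is strictly convex, so an exponent vector of maximal norm among those of
  top degree is not the midpoint of two others. Hence the coefficient at its double is a sum of
  squares of coefficients and cannot cancel.\<close>

lemma deg_le_of_sum_squares:
  fixes g :: "nat \<Rightarrow> 'n::finite rpoly"
  assumes "deg_le (2 * d) (\<Sum>j<k. (g j)\<^sup>2)" "j < k"
  shows "deg_le d (g j)"
proof (rule ccontr)
  assume not_le: "\<not> deg_le d (g j)"
  define K where "K = (\<Union>j<k. Poly_Mapping.keys (g j))"
  define D where "D = Max (mon_degree ` K)"
  define N where "N = (\<lambda>m::'n \<Rightarrow>\<^sub>0 nat. \<Sum>i\<in>UNIV. (real (Poly_Mapping.lookup m i))\<^sup>2)"
  obtain m0 where m0: "m0 \<in> K" "mon_degree m0 > d"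
    using not_le \<open>j < k\<close> by (fastforce simp: deg_le_def K_def)
  have fin: "finite K"
    by (simp add: K_def)
  have le_D: "mon_degree m \<le> D" if "m \<in> K" for m
    using that fin by (simp add: D_def)
  have "d < D"
    using m0 le_D by fastforce
  have "D \<in> mon_degree ` K"
    using fin m0 unfolding D_def by (intro Max_in) auto
  then have ne: "{m \<in> K. mon_degree m = D} \<noteq> {}"
    by auto
  have "Max (N ` {m \<in> K. mon_degree m = D}) \<in> N ` {m \<in> K. mon_degree m = D}"
    using fin ne by (intro Max_in) auto
  then obtain m where m: "m \<in> K" "mon_degree m = D"
    and "N m = Max (N ` {m \<in> K. mon_degree m = D})"
    by auto
  then have max: "N m' \<le> N m" if "m' \<in> K" "mon_degree m' = D" for m'
    using that fin by auto
  have extreme: "a = m \<and> b = m" if "a \<in> K" "b \<in> K" "a + b = m + m" for a b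
  proof -
    have "mon_degree a + mon_degree b = D + D"
      using arg_cong [OF that(3), of mon_degree] m by simp
    then have deg: "mon_degree a = D" "mon_degree b = D"
      using le_D [OF that(1)] le_D [OF that(2)] by auto
    have sum: "real (Poly_Mapping.lookup a i) + real (Poly_Mapping.lookup b i) =
        2 * real (Poly_Mapping.lookup m i)" for i
      using arg_cong [OF that(3), of "\<lambda>p. real (Poly_Mapping.lookup p i)"] by (simp add: lookup_add)
    \<comment> \<open>The parallelogram law in each coordinate, with \<open>a + b = m + m\<close>.
      After summation, the maximality of \<open>N m\<close> leaves no room for a nonzero difference
      of \<open>a\<close> and \<open>b\<close>.\<close>
    have "2 * (real (Poly_Mapping.lookup a i))\<^sup>2 + 2 * (real (Poly_Mapping.lookup b i))\<^sup>2 =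
        4 * (real (Poly_Mapping.lookup m i))\<^sup>2 +
        (real (Poly_Mapping.lookup a i) - real (Poly_Mapping.lookup b i))\<^sup>2" for i
      using arg_cong [OF sum [of i], of "\<lambda>x. x\<^sup>2"] by (simp add: power2_eq_square algebra_simps)
    then have "2 * N a + 2 * N b =
        4 * N m + (\<Sum>i\<in>UNIV. (real (Poly_Mapping.lookup a i) - real (Poly_Mapping.lookup b i))\<^sup>2)"
      by (simp add: N_def sum_distrib_left flip: sum.distrib)
    then have "(\<Sum>i\<in>UNIV. (real (Poly_Mapping.lookup a i) - real (Poly_Mapping.lookup b i))\<^sup>2) \<le> 0"
      using max [OF that(1) deg(1)] max [OF that(2) deg(2)] by linarith
    then have "(\<Sum>i\<in>UNIV. (real (Poly_Mapping.lookup a i) - real (Poly_Mapping.lookup b i))\<^sup>2) = 0"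
      by (meson antisym sum_nonneg zero_le_power2)
    then have "Poly_Mapping.lookup a i = Poly_Mapping.lookup b i" for i
      by (subst (asm) sum_nonneg_eq_0_iff) auto
    then show ?thesis
      using sum by (auto intro!: poly_mapping_eqI)
  qed
  have "Poly_Mapping.lookup ((g i)\<^sup>2) (m + m) = (Poly_Mapping.lookup (g i) m)\<^sup>2" if "i < k" for i
    unfolding power2_eq_square
    by (rule lookup_mult_unique_sum) (use extreme that in \<open>auto simp: K_def\<close>)
  then have coeff: "Poly_Mapping.lookup (\<Sum>j<k. (g j)\<^sup>2) (m + m) =
      (\<Sum>j<k. (Poly_Mapping.lookup (g j) m)\<^sup>2)"
    by (simp add: lookup_sum)
  \<comment> \<open>The degree of \<open>m + m\<close> is \<open>2 * D\<close>, which exceeds the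
    bound \<open>2 * d\<close> on the sum.\<close>
  have "m + m \<notin> Poly_Mapping.keys (\<Sum>j<k. (g j)\<^sup>2)"
    using assms(1) m \<open>d < D\<close> by (fastforce simp: deg_le_def)
  then have "(\<Sum>j<k. (Poly_Mapping.lookup (g j) m)\<^sup>2) = 0"
    using coeff by (simp add: in_keys_iff)
  then have "\<forall>j<k. Poly_Mapping.lookup (g j) m = 0"
    by (subst (asm) sum_nonneg_eq_0_iff) auto
  then show False
    using m(1) by (auto simp: K_def in_keys_iff)
qed

section \<open>Squaring the variables\<close>

text \<open>The substitution of squares for the variables, written as doubling of exponent vectors,
  so that supports and injectivity can be read off directly.\<close>

definition square_vars :: "'n rpoly \<Rightarrow> 'n rpoly" where
  "square_vars p = (\<Sum>m\<in>Poly_Mapping.keys p. Poly_Mapping.single (m + m) (Poly_Mapping.lookup p m))"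

lemma square_vars_single [simp]:
  "square_vars (Poly_Mapping.single m c) = Poly_Mapping.single (m + m) c"
  by (simp add: square_vars_def)

lemma square_vars_zero [simp]: "square_vars 0 = 0"
  by (simp add: square_vars_def)

lemma square_vars_add: "square_vars (p + q) = square_vars p + square_vars q"
  unfolding square_vars_def by (rule setsum_keys_plus_distrib) (auto simp: single_add)

lemma square_vars_sum: "square_vars (\<Sum>i\<in>I. f i) = (\<Sum>i\<in>I. square_vars (f i))"
  by (induction I rule: infinite_finite_induct) (auto simp: square_vars_add)

lemma square_vars_mult: "square_vars (p * q) = square_vars p * square_vars q"
  by (subst mult_eq_sum_single)
    (simp add: square_vars_sum square_vars_def [of p] square_vars_def [of q] sum_product
      mult_single add_ac)

lemma square_vars_one [simp]: "square_vars 1 = 1"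
  using square_vars_single [of 0 1] by simp

lemma square_vars_diff: "square_vars (p - q) = square_vars p - square_vars q"
  by (metis add_diff_cancel_right' diff_add_cancel square_vars_add)

lemma square_vars_power: "square_vars (p ^ k) = square_vars p ^ k"
  by (induction k) (simp_all add: square_vars_mult)

lemma square_vars_prod: "square_vars (\<Prod>i\<in>I. f i) = (\<Prod>i\<in>I. square_vars (f i))"
  by (induction I rule: infinite_finite_induct) (auto simp: square_vars_mult)

lemma square_vars_Const [simp]: "square_vars (Const c) = Const c"
  by (simp add: Const_def)

lemma square_vars_Var [simp]: "square_vars (Var i) = (Var i)\<^sup>2"
  by (simp add: Var_def power2_eq_square mult_single)

lemma square_vars_quad_form:
  "square_vars (quad_form M y) = quad_form M (\<lambda>i. square_vars (y i))"
  by (simp add: quad_form_def square_vars_sum square_vars_mult)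

lemma poly_mapping_double_eq_iff: "m + m = k + k \<longleftrightarrow> m = k" for m k :: "'n \<Rightarrow>\<^sub>0 nat"
  by (metis add_self_div_2 lookup_add poly_mapping_eqI)

lemma lookup_square_vars: "Poly_Mapping.lookup (square_vars p) (m + m) = Poly_Mapping.lookup p m"
proof -
  have "Poly_Mapping.lookup (square_vars p) (m + m) =
      (\<Sum>k\<in>Poly_Mapping.keys p. if k = m then Poly_Mapping.lookup p k else 0)"
    by (simp add: square_vars_def lookup_sum lookup_single when_def poly_mapping_double_eq_iff)
  also have "\<dots> = Poly_Mapping.lookup p m"
    by (simp add: in_keys_iff)
  finally show ?thesis .
qed

text \<open>The coefficients of \<open>p\<close> reappear at the doubled exponents. This is what
  allows the substitution to be undone in an identity.\<close>

lemma square_vars_inj: "square_vars p = square_vars q \<Longrightarrow> p = q"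
  by (rule poly_mapping_eqI) (metis lookup_square_vars)

lemma keys_square_varsE:
  assumes "k \<in> Poly_Mapping.keys (square_vars p)"
  obtains m where "m \<in> Poly_Mapping.keys p" "k = m + m"
  using assms unfolding square_vars_def by (auto elim!: keys_sumE split: if_splits)

lemma deg_le_square_vars: "deg_le d p \<Longrightarrow> deg_le (2 * d) (square_vars p)"
  by (fastforce simp: deg_le_def elim!: keys_square_varsE)

lemma square_vars_SOS:
  assumes "p \<in> SOS"
  shows "square_vars p \<in> SOS"
proof -
  obtain m g where "p = (\<Sum>i<m::nat. (g i)\<^sup>2)"
    using assms unfolding SOS_def by blast
  then show ?thesis
    by (auto simp: square_vars_sum square_vars_power intro!: SOS_sum SOS_square)
qed

section \<open>Sums of squares in the squared variables\<close>

lemma prod_Var: "(\<Prod>i\<in>S. Var i) = Poly_Mapping.single (\<Sum>i\<in>S. Poly_Mapping.single i 1) 1"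
  by (induction S rule: infinite_finite_induct) (auto simp: Var_def mult_single)

lemma homog_prod_Var: "homog (card S) (\<Prod>i\<in>S. Var i)"
  unfolding prod_Var
  using homog_single [of "\<Sum>i\<in>S. Poly_Mapping.single i 1" 1] by (simp add: mon_degree_sum)

text \<open>An exponent vector that is odd exactly on \<open>S\<close> is the indicator vector of
  \<open>S\<close> plus twice its entrywise half, so the product over \<open>S\<close> factors out
  of every term. The second conclusion keeps track of degrees for the bounds on the
  multipliers.\<close>

lemma factor_odd_support:
  fixes p :: "'n::finite rpoly"
  assumes "\<And>m. m \<in> Poly_Mapping.keys p \<Longrightarrow> {i. odd (Poly_Mapping.lookup m i)} = S"
  obtains h where "p = (\<Prod>i\<in>S. Var i) * square_vars h"
    and "\<And>k. k \<in> Poly_Mapping.keys h \<Longrightarrow>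
      \<exists>m\<in>Poly_Mapping.keys p. mon_degree m = 2 * mon_degree k + card S"
proof
  define e :: "'n \<Rightarrow>\<^sub>0 nat" where "e = (\<Sum>i\<in>S. Poly_Mapping.single i 1)"
  define half :: "('n \<Rightarrow>\<^sub>0 nat) \<Rightarrow> 'n \<Rightarrow>\<^sub>0 nat" where "half = Poly_Mapping.map (\<lambda>k. k div 2)"
  define h where "h = (\<Sum>m\<in>Poly_Mapping.keys p.
    Poly_Mapping.single (half m) (Poly_Mapping.lookup p m))"
  have split: "e + (half m + half m) = m" if "m \<in> Poly_Mapping.keys p" for m
  proof (rule poly_mapping_eqI)
    fix i
    have "Poly_Mapping.lookup e i = (if i \<in> S then 1 else 0)"
      by (simp add: e_def lookup_sum lookup_single when_def)
    moreover have "Poly_Mapping.lookup (half m) i = Poly_Mapping.lookup m i div 2"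
      by (simp add: half_def Poly_Mapping.map.rep_eq when_def)
    moreover have "i \<in> S \<longleftrightarrow> odd (Poly_Mapping.lookup m i)"
      using assms [OF that] by auto
    ultimately show "Poly_Mapping.lookup (e + (half m + half m)) i = Poly_Mapping.lookup m i"
      by (auto simp: lookup_add) presburger+
  qed
  have "(\<Prod>i\<in>S. Var i) * square_vars h = (\<Sum>m\<in>Poly_Mapping.keys p.
      Poly_Mapping.single (e + (half m + half m)) (Poly_Mapping.lookup p m))"
    by (simp add: prod_Var e_def h_def square_vars_sum sum_distrib_left mult_single)
  also have "\<dots> = (\<Sum>m\<in>Poly_Mapping.keys p. Poly_Mapping.single m (Poly_Mapping.lookup p m))"
    by (intro sum.cong refl) (simp add: split)
  finally show "p = (\<Prod>i\<in>S. Var i) * square_vars h"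
    by (simp add: poly_mapping_sum_single)
  fix k assume "k \<in> Poly_Mapping.keys h"
  then obtain m where m: "m \<in> Poly_Mapping.keys p" "k = half m"
    unfolding h_def by (auto elim!: keys_sumE split: if_splits)
  then have "mon_degree m = 2 * mon_degree k + card S"
    using arg_cong [OF split, of m mon_degree] by (simp add: e_def mon_degree_sum)
  with m show "\<exists>m\<in>Poly_Mapping.keys p. mon_degree m = 2 * mon_degree k + card S"
    by blast
qed

text \<open>In a square, a product of two monomials has only even exponents iff both monomials have the
  same set of variables with odd exponent. Splitting each \<open>g j\<close> along these sets and
  discarding the cross terms leaves only squares of the form \<open>(x\<^sup>S h(x\<^sup>2))\<^sup>2\<close>.\<close>

lemma square_vars_SOS_decomposition:
  fixes p :: "'n::finite rpoly"
  assumes "square_vars p \<in> SOS" "deg_le r p"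
  obtains \<sigma> where "\<And>S. card S \<le> r \<Longrightarrow> \<sigma> S \<in> SOS_deg (int r - int (card S))"
    and "p = (\<Sum>S | card S \<le> r. \<sigma> S * (\<Prod>i\<in>S. Var i))"
proof -
  obtain k g where g: "square_vars p = (\<Sum>j<k::nat. (g j)\<^sup>2)"
    using assms(1) unfolding SOS_def by blast
  have deg_g: "deg_le r (g j)" if "j < k" for j
    using deg_le_of_sum_squares [of r g k j] deg_le_square_vars [OF assms(2)] that
    by (simp flip: g)
  define odds :: "('n \<Rightarrow>\<^sub>0 nat) \<Rightarrow> 'n set" where "odds = (\<lambda>m. {i. odd (Poly_Mapping.lookup m i)})"
  have odds_iff: "odds (a + b) = {} \<longleftrightarrow> odds a = odds b" for a b
    by (auto simp: odds_def lookup_add)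
  define is_factor where "is_factor j S h \<longleftrightarrow>
    restr (\<lambda>m. odds m = S) (g j) = (\<Prod>i\<in>S. Var i) * square_vars h \<and>
    (\<forall>m\<in>Poly_Mapping.keys h. \<exists>m'\<in>Poly_Mapping.keys (g j).
      mon_degree m' = 2 * mon_degree m + card S)" for j S h
  have "\<exists>h. is_factor j S h" for j S
  proof (rule factor_odd_support)
    fix m assume "m \<in> Poly_Mapping.keys (restr (\<lambda>m. odds m = S) (g j))"
    then show "{i. odd (Poly_Mapping.lookup m i)} = S"
      by (simp add: keys_restr odds_def)
  next
    fix h
    assume "restr (\<lambda>m. odds m = S) (g j) = (\<Prod>i\<in>S. Var i) * square_vars h"
      and "\<And>m. m \<in> Poly_Mapping.keys h \<Longrightarrow>
        \<exists>m'\<in>Poly_Mapping.keys (restr (\<lambda>m. odds m = S) (g j)).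
          mon_degree m' = 2 * mon_degree m + card S"
    then have "is_factor j S h"
      unfolding is_factor_def keys_restr by blast
    then show ?thesis ..
  qed
  then obtain h where is_factor: "is_factor j S (h j S)" for j S
    by metis
  then have h: "restr (\<lambda>m. odds m = S) (g j) = (\<Prod>i\<in>S. Var i) * square_vars (h j S)" for j S
    by (simp add: is_factor_def)
  have deg_h: "2 * mon_degree m + card S \<le> r" if "m \<in> Poly_Mapping.keys (h j S)" "j < k" for m j S
    using is_factor [of j S] that deg_g [OF that(2)] by (metis is_factor_def deg_le_def)
  define \<sigma> where "\<sigma> S = (\<Sum>j<k. (h j S)\<^sup>2)" for S
  \<comment> \<open>All exponents in \<open>square_vars p\<close> are even, so nothing is lost by
    discarding the other terms; on the right-hand side this removes the cross terms.\<close>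
  have "square_vars p = restr (\<lambda>m. odds m = {}) (square_vars p)"
    by (rule restr_id [symmetric])
       (auto simp: odds_def lookup_add elim!: keys_square_varsE)
  also have "\<dots> = (\<Sum>j<k. \<Sum>S\<in>UNIV. (restr (\<lambda>m. odds m = S) (g j))\<^sup>2)"
    unfolding g restr_sum power2_eq_square
    by (intro sum.cong refl restr_mult odds_iff)
  \<comment> \<open>The square of a product of variables is the image of that product under the
    substitution, so each square is itself such an image.\<close>
  also have "\<dots> = (\<Sum>j<k. \<Sum>S\<in>UNIV. square_vars ((h j S)\<^sup>2 * (\<Prod>i\<in>S. Var i)))"
    by (simp add: h square_vars_mult square_vars_power square_vars_prod power_mult_distrib
        prod_power_distrib mult.commute)
  also have "\<dots> = square_vars (\<Sum>S\<in>UNIV. \<sigma> S * (\<Prod>i\<in>S. Var i))"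
    by (subst sum.swap) (simp add: \<sigma>_def square_vars_sum sum_distrib_right)
  finally have "p = (\<Sum>S\<in>UNIV. \<sigma> S * (\<Prod>i\<in>S. Var i))"
    by (rule square_vars_inj)
  \<comment> \<open>For \<open>card S > r\<close> the bound \<open>deg_h\<close> leaves no exponent
    in \<open>h j S\<close>, so these summands are zero.\<close>
  also have "\<dots> = (\<Sum>S | card S \<le> r. \<sigma> S * (\<Prod>i\<in>S. Var i))"
  proof (rule sum.mono_neutral_right)
    have "Poly_Mapping.keys (h j S) = {}" if "\<not> card S \<le> r" "j < k" for j S
      using deg_h [OF _ that(2), of _ S] that(1) by fastforce
    then have "h j S = 0" if "\<not> card S \<le> r" "j < k" for j S
      using that by simp
    then show "\<forall>S\<in>UNIV - {S. card S \<le> r}. \<sigma> S * (\<Prod>i\<in>S. Var i) = 0"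
      by (simp add: \<sigma>_def)
  qed auto
  finally have eq: "p = (\<Sum>S | card S \<le> r. \<sigma> S * (\<Prod>i\<in>S. Var i))" .
  have "\<sigma> S \<in> SOS_deg (int r - int (card S))" if "card S \<le> r" for S
  proof -
    \<comment> \<open>Each factor contributes at most half of \<open>r - card S\<close> to the
      degree, by \<open>deg_h\<close>.\<close>
    have "deg_le (r - card S) ((h j S)\<^sup>2)" if "j < k" for j
      unfolding deg_le_def
    proof
      fix m assume "m \<in> Poly_Mapping.keys ((h j S)\<^sup>2)"
      then obtain a b where "a \<in> Poly_Mapping.keys (h j S)" "b \<in> Poly_Mapping.keys (h j S)" "m = a + b"
        unfolding power2_eq_square by (rule keys_multE)
      then show "mon_degree m \<le> r - card S"
        using deg_h [of a j S] deg_h [of b j S] that by simp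
    qed
    then have "\<sigma> S \<in> SOS_deg (int (r - card S))"
      unfolding SOS_deg_nat_iff \<sigma>_def by (auto intro!: SOS_sum SOS_square deg_le_sum)
    then show ?thesis
      using that by (simp add: of_nat_diff)
  qed
  with eq show thesis
    using that by blast
qed

section \<open>Homogenization along the sphere\<close>

definition sqnorm :: "'n::finite rpoly" where
  "sqnorm = (\<Sum>i\<in>UNIV. (Var i)\<^sup>2)"

lemma Var_square: "(Var i)\<^sup>2 = Poly_Mapping.single (Poly_Mapping.single i 2) 1"
  by (simp add: Var_def power2_eq_square mult_single numeral_2_eq_2 flip: single_add)

lemma lookup_sqnorm: "Poly_Mapping.lookup sqnorm (Poly_Mapping.single i 2) = 1"
proof -
  have "Poly_Mapping.single j 2 = Poly_Mapping.single i (2::nat) \<longleftrightarrow> j = i" for j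
    by (metis lookup_single_eq lookup_single_not_eq zero_neq_numeral)
  then show ?thesis
    by (simp add: sqnorm_def Var_square lookup_sum lookup_single when_def)
qed

lemma keys_sqnormE:
  assumes "m \<in> Poly_Mapping.keys sqnorm"
  obtains j where "m = Poly_Mapping.single j 2"
  using assms unfolding sqnorm_def Var_square by (auto elim!: keys_sumE)

lemma homog_sqnorm: "homog 2 sqnorm"
  by (auto simp: homog_def elim!: keys_sqnormE)

lemma square_vars_sum_Var: "square_vars (\<Sum>i\<in>UNIV. Var i) = sqnorm"
  by (simp add: square_vars_sum sqnorm_def)

lemma sqnorm_mult_SOS: "p \<in> SOS \<Longrightarrow> sqnorm * p \<in> SOS"
  unfolding sqnorm_def sum_distrib_right by (intro SOS_sum SOS_mult_square)

text \<open>If \<open>F = w (sqnorm - 1)\<close> with \<open>w \<noteq> 0\<close>, then \<open>F\<close> has a term in the lowest degree of \<open>w\<close>, and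
  another one two degrees above the highest degree of \<open>w\<close>.\<close>

lemma homog_dvd_sqnorm_minus_one:
  fixes F :: "'n::finite rpoly"
  assumes "homog d F" "sqnorm - 1 dvd F"
  shows "F = 0"
proof -
  obtain w where F: "F = (sqnorm - 1) * w"
    using assms(2) by blast
  have lookup_F: "Poly_Mapping.lookup F m =
      Poly_Mapping.lookup (sqnorm * w) m - Poly_Mapping.lookup w m" for m
    by (simp add: F left_diff_distrib lookup_minus)
  have deg_F: "mon_degree m = d" if "Poly_Mapping.lookup F m \<noteq> 0" for m
    using assms(1) that by (simp add: homog_def in_keys_iff)
  have "w = 0"
  proof (rule ccontr)
    assume "w \<noteq> 0"
    then have ne: "Poly_Mapping.keys w \<noteq> {}"
      by simp
    have "Min (mon_degree ` Poly_Mapping.keys w) \<in> mon_degree ` Poly_Mapping.keys w"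
      using ne by (intro Min_in) auto
    then obtain l where l: "l \<in> Poly_Mapping.keys w"
      and "mon_degree l = Min (mon_degree ` Poly_Mapping.keys w)"
      by auto
    then have l_min: "mon_degree l \<le> mon_degree m" if "m \<in> Poly_Mapping.keys w" for m
      using that by simp
    \<comment> \<open>Every exponent of \<open>sqnorm * w\<close> has degree at least 2 above the
      minimum, so the lowest term of \<open>w\<close> survives in \<open>F\<close>.\<close>
    have "l \<notin> Poly_Mapping.keys (sqnorm * w)"
    proof
      assume "l \<in> Poly_Mapping.keys (sqnorm * w)"
      then obtain j b where "b \<in> Poly_Mapping.keys w" "l = Poly_Mapping.single j 2 + b"
        by (auto elim!: keys_multE keys_sqnormE)
      then show False
        using l_min [of b] by simp
    qed
    then have d_low: "d = mon_degree l"
      using l deg_F [of l] by (simp add: lookup_F in_keys_iff)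
    define D where "D = Max (mon_degree ` Poly_Mapping.keys w)"
    have D_max: "mon_degree m \<le> D" if "m \<in> Poly_Mapping.keys w" for m
      using that by (simp add: D_def)
    define A where "A = {m \<in> Poly_Mapping.keys w. mon_degree m = D}"
    \<comment> \<open>Any variable will do. Among the top-degree exponents of \<open>w\<close>, one
      with the largest exponent in this variable is chosen.\<close>
    define i :: 'n where "i = undefined"
    have "D \<in> mon_degree ` Poly_Mapping.keys w"
      using ne unfolding D_def by (intro Max_in) auto
    then have "A \<noteq> {}" "finite A"
      by (auto simp: A_def)
    then have "Max ((\<lambda>m. Poly_Mapping.lookup m i) ` A) \<in> (\<lambda>m. Poly_Mapping.lookup m i) ` A"
      by (intro Max_in) auto
    then obtain m where m: "m \<in> A"
      and "Poly_Mapping.lookup m i = Max ((\<lambda>m. Poly_Mapping.lookup m i) ` A)"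
      by auto
    then have m_max: "Poly_Mapping.lookup b i \<le> Poly_Mapping.lookup m i" if "b \<in> A" for b
      using that \<open>finite A\<close> by simp
    \<comment> \<open>Reaching this exponent through another square, of variable \<open>j\<close>,
      would require a top-degree exponent of \<open>w\<close> whose entry at \<open>i\<close> is
      larger by 2 than that of \<open>m\<close>.\<close>
    have "Poly_Mapping.lookup (sqnorm * w) (Poly_Mapping.single i 2 + m) =
        Poly_Mapping.lookup sqnorm (Poly_Mapping.single i 2) * Poly_Mapping.lookup w m"
    proof (rule lookup_mult_unique_sum)
      fix a b
      assume "a \<in> Poly_Mapping.keys sqnorm" and b: "b \<in> Poly_Mapping.keys w"
        and eq: "a + b = Poly_Mapping.single i 2 + m"
      then obtain j where a: "a = Poly_Mapping.single j 2"
        by (elim keys_sqnormE)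
      have "mon_degree b = D"
        using arg_cong [OF eq, of mon_degree] m by (simp add: a A_def)
      with b have "Poly_Mapping.lookup b i \<le> Poly_Mapping.lookup m i"
        by (intro m_max) (simp add: A_def)
      then have "j = i"
        using arg_cong [OF eq, of "\<lambda>p. Poly_Mapping.lookup p i"]
        by (simp add: a lookup_add lookup_single when_def split: if_splits)
      then show "a = Poly_Mapping.single i 2 \<and> b = m"
        using eq by (simp add: a)
    qed
    then have "Poly_Mapping.lookup (sqnorm * w) (Poly_Mapping.single i 2 + m) \<noteq> 0"
      using m by (simp add: lookup_sqnorm A_def in_keys_iff)
    moreover have "Poly_Mapping.lookup w (Poly_Mapping.single i 2 + m) = 0"
      using D_max [of "Poly_Mapping.single i 2 + m"] m by (auto simp: A_def in_keys_iff)
    ultimately have "d = D + 2"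
      using deg_F [of "Poly_Mapping.single i 2 + m"] m by (simp add: lookup_F A_def)
    then show False
      using d_low D_max [OF l] by simp
  qed
  then show ?thesis
    by (simp add: F)
qed

section \<open>Congruences and homogeneous representatives\<close>

lemma dvd_diff_mult:
  fixes t :: "'a::comm_ring_1"
  assumes "t dvd a - b" "t dvd c - d"
  shows "t dvd a * c - b * d"
proof -
  have "a * c - b * d = (a - b) * c + b * (c - d)"
    by (simp add: algebra_simps)
  then show ?thesis
    using assms by simp
qed

lemma minus_one_dvd_power_minus_one: "x - 1 dvd x ^ k - 1" for x :: "'a::comm_ring_1"
  by (simp add: power_diff_1_eq)

text \<open>Each term is padded to degree \<open>d\<close> by a power of \<open>sqnorm\<close>,
  which is congruent to 1. The padding has even degree, hence the parity condition.\<close>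

lemma homogenize:
  fixes p :: "'n::finite rpoly"
  assumes "\<And>m. m \<in> Poly_Mapping.keys p \<Longrightarrow> mon_degree m \<le> d \<and> even (d - mon_degree m)"
  obtains q where "homog d q" "sqnorm - 1 dvd q - p"
proof
  define q where "q = (\<Sum>m\<in>Poly_Mapping.keys p.
    sqnorm ^ ((d - mon_degree m) div 2) * Poly_Mapping.single m (Poly_Mapping.lookup p m))"
  show "homog d q"
    unfolding q_def
  proof (rule homog_sum)
    fix m assume "m \<in> Poly_Mapping.keys p"
    then have "(d - mon_degree m) div 2 * 2 + mon_degree m = d"
      using assms by simp
    then show "homog d (sqnorm ^ ((d - mon_degree m) div 2) *
        Poly_Mapping.single m (Poly_Mapping.lookup p m))"
      using homog_mult [OF homog_power [OF homog_sqnorm] homog_single] by metis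
  qed
  have "q - p = (\<Sum>m\<in>Poly_Mapping.keys p. (sqnorm ^ ((d - mon_degree m) div 2) - 1) *
      Poly_Mapping.single m (Poly_Mapping.lookup p m))"
    by (simp add: q_def left_diff_distrib sum_subtractf poly_mapping_sum_single)
  then show "sqnorm - 1 dvd q - p"
    by (auto intro!: dvd_sum dvd_mult2 minus_one_dvd_power_minus_one)
qed

section \<open>Comparison of the hierarchies\<close>

lemma LAS_simplex_subset_LAS_simplex_P:
  assumes "r \<ge> 1"
  shows "(LAS_simplex r :: (real^'n^'n) set) \<subseteq> LAS_simplex_P r"
proof
  fix M :: "real^'n^'n"
  assume "M \<in> LAS_simplex r"
  then obtain \<sigma>\<^sub>0 \<sigma> q where M: "M \<in> sym_matrices" and \<sigma>\<^sub>0: "\<sigma>\<^sub>0 \<in> SOS_deg (int r)"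
    and \<sigma>: "\<And>i. \<sigma> i \<in> SOS_deg (int r - 1)" and q: "q \<in> simplex_ideal"
    and eq: "quad_form M Var = \<sigma>\<^sub>0 + (\<Sum>i\<in>UNIV. \<sigma> i * Var i) + q"
    unfolding LAS_simplex_def by blast
  \<comment> \<open>Only the empty set and the singletons carry multipliers. For all other sets the
    value 0 lies in \<open>SOS_deg\<close> for any bound, and \<open>r \<ge> 1\<close> keeps the
    singletons in the index range.\<close>
  define \<tau> where "\<tau> S = (if S = {} then \<sigma>\<^sub>0 else if card S = 1 then \<sigma> (the_elem S) else 0)" for S
  define T :: "'n set set" where "T = (\<lambda>i. {i}) ` UNIV"
  have "(\<Sum>S | card S \<le> r. \<tau> S * (\<Prod>i\<in>S. Var i)) =
      (\<Sum>S\<in>insert {} T. \<tau> S * (\<Prod>i\<in>S. Var i))"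
    using assms by (intro sum.mono_neutral_right) (auto simp: T_def \<tau>_def card_1_singleton_iff)
  also have "\<dots> = \<sigma>\<^sub>0 + (\<Sum>S\<in>T. \<tau> S * (\<Prod>i\<in>S. Var i))"
    by (subst sum.insert) (auto simp: T_def \<tau>_def)
  also have "(\<Sum>S\<in>T. \<tau> S * (\<Prod>i\<in>S. Var i)) = (\<Sum>i\<in>UNIV. \<sigma> i * Var i)"
    unfolding T_def by (subst sum.reindex) (auto simp: \<tau>_def)
  finally have "quad_form M Var = (\<Sum>S | card S \<le> r. \<tau> S * (\<Prod>i\<in>S. Var i)) + q"
    by (simp add: eq)
  moreover have "\<tau> S \<in> SOS_deg (int r - int (card S))" for S
    using \<sigma>\<^sub>0 \<sigma> by (auto simp: \<tau>_def) (simp add: SOS_deg_def)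
  ultimately show "M \<in> LAS_simplex_P r"
    unfolding LAS_simplex_P_def using M q by blast
qed

text \<open>Under the substitution a product of variables becomes a square, so every term of the
  certificate becomes a sum of squares. Each term has degree at most
  \<open>(r - card S) + card S = r\<close> before the substitution, which doubles it.\<close>

lemma LAS_simplex_P_subset_LAS_sphere:
  "(LAS_simplex_P r :: (real^'n^'n) set) \<subseteq> LAS_sphere (2 * r)"
proof
  fix M :: "real^'n^'n"
  assume "M \<in> LAS_simplex_P r"
  then obtain \<sigma> u where M: "M \<in> sym_matrices"
    and \<sigma>: "\<And>S. card S \<le> r \<Longrightarrow> \<sigma> S \<in> SOS_deg (int r - int (card S))"
    and eq: "quad_form M Var = (\<Sum>S | card S \<le> r. \<sigma> S * (\<Prod>i\<in>S. Var i)) +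
      u * ((\<Sum>i\<in>UNIV. Var i) - 1)"
    unfolding LAS_simplex_P_def simplex_ideal_eq_range by blast
  define \<sigma>\<^sub>0 where "\<sigma>\<^sub>0 = square_vars (\<Sum>S | card S \<le> r. \<sigma> S * (\<Prod>i\<in>S. Var i))"
  have "square_vars (quad_form M Var) = \<sigma>\<^sub>0 + square_vars u * (sqnorm - 1)"
    by (simp add: eq \<sigma>\<^sub>0_def square_vars_add square_vars_mult square_vars_diff square_vars_sum_Var)
  then have "quad_form M (\<lambda>i. (Var i)\<^sup>2) = \<sigma>\<^sub>0 + square_vars u * ((\<Sum>i\<in>UNIV. (Var i)\<^sup>2) - 1)"
    by (simp add: square_vars_quad_form sqnorm_def)
  moreover have \<sigma>: "\<sigma> S \<in> SOS" "deg_le (r - card S) (\<sigma> S)" if "card S \<le> r" for S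
    using \<sigma> [OF that] that SOS_deg_nat_iff [of "\<sigma> S" "r - card S"] by (simp_all add: of_nat_diff)
  have "\<sigma>\<^sub>0 \<in> SOS_deg (int (2 * r))"
    unfolding SOS_deg_nat_iff
  proof
    have "square_vars (\<sigma> S * (\<Prod>i\<in>S. Var i)) \<in> SOS" if "card S \<le> r" for S
      using SOS_mult_square [OF square_vars_SOS [OF \<sigma>(1) [OF that]], of "\<Prod>i\<in>S. Var i"]
      by (simp add: square_vars_mult square_vars_prod prod_power_distrib mult.commute)
    then show "\<sigma>\<^sub>0 \<in> SOS"
      by (auto simp: \<sigma>\<^sub>0_def square_vars_sum intro!: SOS_sum)
    have "deg_le r (\<sigma> S * (\<Prod>i\<in>S. Var i))" if "card S \<le> r" for S
      using deg_le_mult [OF \<sigma>(2) [OF that] homog_imp_deg_le [OF homog_prod_Var, of S]] that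
      by simp
    then show "deg_le (2 * r) \<sigma>\<^sub>0"
      unfolding \<sigma>\<^sub>0_def by (intro deg_le_square_vars deg_le_sum) auto
  qed
  ultimately show "M \<in> LAS_sphere (2 * r)"
    unfolding LAS_sphere_def using M by blast
qed

text \<open>Each \<open>g j\<close> splits into \<open>a j\<close>, with degrees of the parity of
  \<open>r\<close>, and \<open>b j\<close>, with the others. These homogenize to degrees
  \<open>r\<close> and \<open>r - 1\<close>; one factor \<open>sqnorm\<close> brings the second
  square to degree \<open>2 * r\<close> as well. The resulting sum \<open>Q\<close> and
  \<open>sqnorm ^ (r - 2) * f\<close> are congruent and homogeneous of the same degree, hence
  equal.\<close>

lemma LAS_sphere_subset_cone_K:
  assumes "r \<ge> 2"
  shows "(LAS_sphere (2 * r) :: (real^'n^'n) set) \<subseteq> cone_K (r - 2)"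
proof
  fix M :: "real^'n^'n"
  assume "M \<in> LAS_sphere (2 * r)"
  define f where "f = quad_form M (\<lambda>i. (Var i)\<^sup>2)"
  obtain \<sigma>\<^sub>0 u where M: "M \<in> sym_matrices" and \<sigma>\<^sub>0: "\<sigma>\<^sub>0 \<in> SOS_deg (int (2 * r))"
    and f: "f = \<sigma>\<^sub>0 + u * (sqnorm - 1)"
    using \<open>M \<in> LAS_sphere (2 * r)\<close> unfolding LAS_sphere_def f_def sqnorm_def by blast
  obtain k g where g: "\<sigma>\<^sub>0 = (\<Sum>j<k::nat. (g j)\<^sup>2)"
    using \<sigma>\<^sub>0 unfolding SOS_deg_def SOS_def by blast
  have deg_g: "deg_le r (g j)" if "j < k" for j
    using deg_le_of_sum_squares [of r g k j] \<sigma>\<^sub>0 that unfolding SOS_deg_nat_iff g by blast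
  have homog_f: "homog 4 f"
    unfolding f_def
    using homog_quad_form [of 2 "\<lambda>i. (Var i)\<^sup>2" M, OF homog_power [OF homog_Var, of 2, simplified]]
    by simp
  define ev where "ev p = restr (\<lambda>m. even (mon_degree m)) p" for p :: "'n rpoly"
  define part where "part c p = restr (\<lambda>m. even (mon_degree m + r) = c) p" for c and p :: "'n rpoly"
  define a where "a j = part True (g j)" for j
  define b where "b j = part False (g j)" for j

  have "ev ((g j)\<^sup>2) = (\<Sum>c\<in>UNIV. part c (g j) * part c (g j))" for j
    unfolding ev_def part_def power2_eq_square by (rule restr_mult) auto
  then have ev_\<sigma>\<^sub>0: "ev \<sigma>\<^sub>0 = (\<Sum>j<k. (a j)\<^sup>2 + (b j)\<^sup>2)"
    by (simp add: g ev_def restr_sum a_def b_def UNIV_bool power2_eq_square add.commute)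
  \<comment> \<open>Since \<open>sqnorm - 1\<close> has terms of even degree only, the even part of
    a multiple is again a multiple, by the even part of \<open>u\<close>.\<close>
  have "ev (u * (sqnorm - 1)) = (\<Sum>c\<in>UNIV. restr (\<lambda>m. even (mon_degree m) = c) u *
      restr (\<lambda>m. even (mon_degree m) = c) (sqnorm - 1))"
    unfolding ev_def by (rule restr_mult) auto
  moreover have "even (mon_degree m)" if "m \<in> Poly_Mapping.keys (sqnorm - 1 :: 'n rpoly)" for m
    using that keys_diff [of "sqnorm :: 'n rpoly" 1] homog_sqnorm by (fastforce simp: homog_def)
  ultimately have "sqnorm - 1 dvd ev (u * (sqnorm - 1))"
    by (simp add: UNIV_bool restr_id restr_eq_0)
  moreover have "f = ev f"
    unfolding ev_def using homog_f by (intro restr_id [symmetric]) (simp add: homog_def)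
  ultimately have dvd_f: "sqnorm - 1 dvd f - (\<Sum>j<k. (a j)\<^sup>2 + (b j)\<^sup>2)"
    by (metis add_diff_cancel_left' ev_\<sigma>\<^sub>0 ev_def f restr_add)

  have "\<exists>q. homog r q \<and> sqnorm - 1 dvd q - a j" if "j < k" for j
    by (rule homogenize [of "a j" r])
       (use deg_g [OF that] in \<open>auto simp: a_def part_def keys_restr deg_le_def\<close>)
  then obtain A where A: "\<And>j. j < k \<Longrightarrow> homog r (A j)"
    "\<And>j. j < k \<Longrightarrow> sqnorm - 1 dvd A j - a j"
    by metis
  \<comment> \<open>The parity excludes degree \<open>r\<close> itself, so the bound drops by one
    and the remaining gap is even.\<close>
  have "mon_degree m \<le> r - 1 \<and> even (r - 1 - mon_degree m)"
    if "m \<in> Poly_Mapping.keys (b j)" "j < k" for m j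
  proof -
    have "mon_degree m \<le> r" "odd (mon_degree m + r)"
      using that deg_g [OF that(2)] by (auto simp: b_def part_def keys_restr deg_le_def)
    then have "mon_degree m < r"
      by (cases "mon_degree m = r") auto
    then obtain t where "r = Suc (mon_degree m + t)"
      using less_imp_Suc_add by blast
    with \<open>odd (mon_degree m + r)\<close> show ?thesis
      by auto
  qed
  then have "\<exists>q. homog (r - 1) q \<and> sqnorm - 1 dvd q - b j" if "j < k" for j
    using homogenize [of "b j" "r - 1"] that by metis
  then obtain B where B: "\<And>j. j < k \<Longrightarrow> homog (r - 1) (B j)"
    "\<And>j. j < k \<Longrightarrow> sqnorm - 1 dvd B j - b j"
    by metis
  define Q where "Q = (\<Sum>j<k. (A j)\<^sup>2 + sqnorm * (B j)\<^sup>2)"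
  have "homog (2 * r) ((A j)\<^sup>2 + sqnorm * (B j)\<^sup>2)" if "j < k" for j
  proof -
    have "2 + 2 * (r - 1) = 2 * r"
      using assms by simp
    then have "homog (2 * r) (sqnorm * (B j)\<^sup>2)"
      using homog_mult [OF homog_sqnorm homog_power [OF B(1) [OF that], of 2]] by metis
    then show ?thesis
      using homog_power [OF A(1) [OF that], of 2] keys_add by (fastforce simp: homog_def)
  qed
  then have homog_Q: "homog (2 * r) Q"
    unfolding Q_def by (intro homog_sum) auto
  \<comment> \<open>The subtraction is truncated, so this identity depends on
    \<open>r \<ge> 2\<close>; it is where the exponent \<open>r - 2\<close> is matched with the
    bound \<open>2 * r\<close>.\<close>
  have "(r - 2) * 2 + 4 = 2 * r"
    using assms by simp
  then have "homog (2 * r) (sqnorm ^ (r - 2) * f)"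
    using homog_mult [OF homog_power [OF homog_sqnorm] homog_f] by metis
  then have homog_diff: "homog (2 * r) (sqnorm ^ (r - 2) * f - Q)"
    using homog_Q by (rule homog_diff)
  have "sqnorm - 1 dvd ((A j)\<^sup>2 + sqnorm * (B j)\<^sup>2) - ((a j)\<^sup>2 + (b j)\<^sup>2)" if "j < k" for j
  proof -
    have "sqnorm - 1 dvd A j * A j - a j * a j"
      using A(2) [OF that] by (intro dvd_diff_mult)
    moreover have "sqnorm - 1 dvd sqnorm * (B j * B j) - 1 * (b j * b j)"
      using B(2) [OF that] by (intro dvd_diff_mult) auto
    ultimately have "sqnorm - 1 dvd
        (A j * A j - a j * a j) + (sqnorm * (B j * B j) - 1 * (b j * b j))"
      by (rule dvd_add)
    then show ?thesis
      by (simp add: power2_eq_square add_diff_add)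
  qed
  then have "sqnorm - 1 dvd Q - (\<Sum>j<k. (a j)\<^sup>2 + (b j)\<^sup>2)"
    unfolding Q_def sum_subtractf [symmetric] by (intro dvd_sum) auto
  with dvd_diff_mult [OF minus_one_dvd_power_minus_one dvd_f]
  have "sqnorm - 1 dvd (sqnorm ^ (r - 2) * f - 1 * (\<Sum>j<k. (a j)\<^sup>2 + (b j)\<^sup>2)) -
      (Q - (\<Sum>j<k. (a j)\<^sup>2 + (b j)\<^sup>2))"
    by (rule dvd_diff)
  then have "sqnorm - 1 dvd sqnorm ^ (r - 2) * f - Q"
    by simp
  then have "sqnorm ^ (r - 2) * f = Q"
    using homog_dvd_sqnorm_minus_one [OF homog_diff] by simp
  moreover have "Q \<in> SOS"
    unfolding Q_def by (intro SOS_sum SOS_add SOS_square sqnorm_mult_SOS)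
  ultimately show "M \<in> cone_K (r - 2)"
    using M unfolding cone_K_def f_def sqnorm_def by simp
qed

text \<open>The form \<open>p\<close> is homogeneous of degree \<open>r\<close>, and its image under
  the substitution is exactly the sum of squares that the cone provides. The decomposition thus
  applies to \<open>p\<close>, and replacing \<open>l ^ (r - 2)\<close> by 1 costs only an element
  of the ideal.\<close>

lemma cone_K_subset_LAS_simplex_P:
  assumes "r \<ge> 2"
  shows "(cone_K (r - 2) :: (real^'n^'n) set) \<subseteq> LAS_simplex_P r"
proof
  fix M :: "real^'n^'n"
  assume "M \<in> cone_K (r - 2)"
  then have M: "M \<in> sym_matrices"
    and sos: "sqnorm ^ (r - 2) * quad_form M (\<lambda>i. (Var i)\<^sup>2) \<in> SOS"
    unfolding cone_K_def sqnorm_def by auto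
  define l :: "'n rpoly" where "l = (\<Sum>i\<in>UNIV. Var i)"
  define p where "p = l ^ (r - 2) * quad_form M Var"
  have "homog 1 l"
    unfolding l_def by (intro homog_sum homog_Var)
  then have "homog ((r - 2) * 1 + 2 * 1) p"
    unfolding p_def by (intro homog_mult homog_power homog_quad_form homog_Var)
  moreover have "(r - 2) * 1 + 2 * 1 = r"
    using assms by simp
  ultimately have "deg_le r p"
    by (intro homog_imp_deg_le) (simp only:)
  moreover have "square_vars p \<in> SOS"
    using sos by (simp add: p_def l_def square_vars_mult square_vars_power square_vars_sum_Var
        square_vars_quad_form)
  ultimately obtain \<sigma> where \<sigma>: "\<And>S. card S \<le> r \<Longrightarrow> \<sigma> S \<in> SOS_deg (int r - int (card S))"
    and p: "p = (\<Sum>S | card S \<le> r. \<sigma> S * (\<Prod>i\<in>S. Var i))"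
    using square_vars_SOS_decomposition by blast
  obtain v where "l ^ (r - 2) - 1 = (l - 1) * v"
    by (rule dvdE [OF minus_one_dvd_power_minus_one])
  then have power: "l ^ (r - 2) = 1 + (l - 1) * v"
    by (simp add: algebra_simps)
  have "quad_form M Var = p + (- v * quad_form M Var) * (l - 1)"
    unfolding p_def power by (simp add: algebra_simps)
  moreover have "(- v * quad_form M Var) * (l - 1) \<in> simplex_ideal"
    unfolding simplex_ideal_eq_range l_def by blast
  ultimately show "M \<in> LAS_simplex_P r"
    unfolding LAS_simplex_P_def p using M \<sigma> by blast
qed

text \<open>The inclusions among the last three sets close a cycle, which gives the equalities; the
  first set enters through \<open>LAS_simplex_P\<close>.\<close>

theorem theorem3p1:
  fixes r :: nat
  assumes "r \<ge> 2"
  shows "(LAS_simplex r :: (real^'n^'n) set) \<subseteq> cone_K (r - 2) \<and>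
    (cone_K (r - 2) :: (real^'n^'n) set) = LAS_simplex_P r \<and>
    (LAS_simplex_P r :: (real^'n^'n) set) = LAS_sphere (2 * r)"
  using LAS_simplex_subset_LAS_simplex_P [of r, where 'n = 'n]
    LAS_simplex_P_subset_LAS_sphere [of r, where 'n = 'n]
    LAS_sphere_subset_cone_K [OF assms, where 'n = 'n]
    cone_K_subset_LAS_simplex_P [OF assms, where 'n = 'n] assms
  by auto

end
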